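(* Let $k\geqslant 1$ and $n\geqslant 1$ be integers, and let $L_1,\ldots,L_n$ be sets (of symbols), each of size at least $2k+10\sqrt{k}$. Then there exists a sequence $S=s_1s_2\ldots s_n$ with $s_i\in L_i$ for every $i=1,\ldots,n$ that is nonrepetitive up to $\bmod\ k$.
   Context: A finite sequence $x_1x_2\ldots x_m$ contains a repetition of size $h\geqslant 1$ if it has a block of consecutive terms of the form $y_1\ldots y_h y_1\ldots y_h$ (two identical adjacent blocks of length $h$); it is nonrepetitive if it contains no repetition of any size $h\geqslant 1$. A sequence $S=s_1\ldots s_n$ is nonrepetitive up to $\bmod\ k$ if for every $d\in\{1,2,\ldots,k\}$ and every starting index $i\in\{1,\ldots,n\}$, the subsequence $s_i s_{i+d} s_{i+2d}\ldots s_{i+td}$ (where $t$ is the largest integer with $i+td\leqslant n$) is nonrepetitive. *)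

theory Defs
  imports Complex_Main
begin

definition has_repetition :: "nat \<Rightarrow> 'a list \<Rightarrow> bool" where
  "has_repetition h xs \<longleftrightarrow>
     (\<exists>us ys vs. length ys = h \<and> xs = us @ ys @ ys @ vs)"

definition nonrepetitive :: "'a list \<Rightarrow> bool" where
  "nonrepetitive xs \<longleftrightarrow> (\<forall>h\<ge>1. \<not> has_repetition h xs)"

text \<open>
  A sequence \<open>s\<^sub>1 \<dots> s\<^sub>n\<close> is a function on \<^typ>\<open>nat\<close> together with its length \<open>n\<close>; only the
  values at the indices \<open>1, \<dots>, n\<close> matter. In the following, \<open>1 \<le> i \<le> n\<close> and \<open>d \<ge> 1\<close> are
  intended.
\<close>

definition mod_subseq :: "nat \<Rightarrow> (nat \<Rightarrow> 'a) \<Rightarrow> nat \<Rightarrow> nat \<Rightarrow> 'a list" where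
  "mod_subseq n s d i =
     map (\<lambda>j. s (i + j * d)) [0..<Suc (GREATEST t. i + t * d \<le> n)]"

definition nonrepetitive_up_to_mod :: "nat \<Rightarrow> nat \<Rightarrow> (nat \<Rightarrow> 'a) \<Rightarrow> bool" where
  "nonrepetitive_up_to_mod k n s \<longleftrightarrow>
     (\<forall>d\<in>{1..k}. \<forall>i\<in>{1..n}. nonrepetitive (mod_subseq n s d i))"

lemma Greatest_mod_subseq:
  fixes i n d :: nat
  assumes "i \<le> n" "1 \<le> d"
  shows "(GREATEST t. i + t * d \<le> n) = (n - i) div d"
proof (rule Greatest_equality)
  have "(n - i) div d * d \<le> n - i" by simp
  then show "i + (n - i) div d * d \<le> n" using assms by linarith
next
  fix t assume "i + t * d \<le> n"
  then have "t * d \<le> n - i" by simp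
  then show "t \<le> (n - i) div d"
    using assms by (simp add: less_eq_div_iff_mult_less_eq)
qed

end

theory Submission
  imports Defs "HOL-Library.FuncSet"
begin

text \<open>
  The proof is Rosenfeld's counting argument, applied to partial sequences on arbitrary finite sets
  of positions instead of prefixes. Let \<open>c(A)\<close> be the number of list colorings of the position set
  \<open>A\<close> without a repetition whose positions all lie in \<open>A\<close>. With \<open>\<beta> = 1 + 2 \<surd>k\<close> one shows
  \<open>c(A \<union> {x}) \<ge> \<beta> c(A)\<close> by induction on the size of \<open>A\<close>. Of the \<open>|L x| c(A)\<close> extensions to \<open>x\<close> of
  the good colorings of \<open>A\<close>, a bad one contains a repetition through \<open>x\<close>, say of size \<open>h\<close>; it is
  determined by the repetition and by its restriction to the complement of the half containing \<open>x\<close>,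
  so by induction there are at most \<open>c(A) / \<beta>^(h-1)\<close> of these for each of the \<open>2hk\<close> possible
  repetitions. Summing over \<open>h\<close>, at most \<open>2k c(A) / (1 - 1/\<beta>)\<^sup>2\<close> extensions are bad, and
  \<open>\<beta> + 2k / (1 - 1/\<beta>)\<^sup>2 = 2k + 4 \<surd>k + 3/2 \<le> 2k + 10 \<surd>k\<close>.
\<close>

section \<open>Repetitions along arithmetic progressions and colorings that avoid them\<close>

definition progression :: "nat \<Rightarrow> nat \<Rightarrow> nat \<Rightarrow> nat set" where
  "progression a d m = (\<lambda>j. a + j * d) ` {..<m}"

definition repeats :: "(nat \<Rightarrow> 'a) \<Rightarrow> nat \<Rightarrow> nat \<Rightarrow> nat \<Rightarrow> bool" where
  "repeats f a d h \<longleftrightarrow> (\<forall>j<h. f (a + j * d) = f (a + (j + h) * d))"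

text \<open>Extensionality in \<open>PiE\<close> fixes the values outside \<open>A\<close>, so
  \<open>card\<close> counts colorings by their values on \<open>A\<close> alone.\<close>

definition colorings :: "nat \<Rightarrow> (nat \<Rightarrow> 'a set) \<Rightarrow> nat set \<Rightarrow> (nat \<Rightarrow> 'a) set" where
  "colorings k L A = {f \<in> PiE A L. \<forall>a d h. d \<in> {1..k} \<longrightarrow> 1 \<le> h \<longrightarrow>
     progression a d (2 * h) \<subseteq> A \<longrightarrow> \<not> repeats f a d h}"

lemma card_progression: "d \<ge> 1 \<Longrightarrow> card (progression a d m) = m"
  unfolding progression_def by (subst card_image) (auto simp: inj_on_def)

lemma repeats_cong:
  assumes "\<And>y. y \<in> progression a d (2 * h) \<Longrightarrow> f y = g y"
  shows "repeats f a d h \<longleftrightarrow> repeats g a d h"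
proof -
  have "f (a + j * d) = g (a + j * d)" if "j < 2 * h" for j
    using assms that unfolding progression_def by blast
  then show ?thesis unfolding repeats_def by simp
qed

lemma finite_colorings:
  assumes "finite A" "\<And>i. i \<in> A \<Longrightarrow> finite (L i)"
  shows "finite (colorings k L A)"
  by (rule finite_subset[of _ "PiE A L"]) (auto simp: colorings_def intro!: finite_PiE assms)

lemma restrict_colorings:
  assumes "f \<in> colorings k L A" "B \<subseteq> A"
  shows "restrict f B \<in> colorings k L B"
proof -
  have "\<not> repeats (restrict f B) a d h"
    if "d \<in> {1..k}" "1 \<le> h" "progression a d (2 * h) \<subseteq> B" for a d h
  proof -
    have "repeats (restrict f B) a d h \<longleftrightarrow> repeats f a d h"
      by (rule repeats_cong) (use that(3) in auto)
    then show ?thesis using assms that unfolding colorings_def by blast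
  qed
  moreover have "restrict f B \<in> PiE B L"
    using assms by (auto simp: colorings_def PiE_iff)
  ultimately show ?thesis unfolding colorings_def by blast
qed

text \<open>Restriction to \<open>B - Q\<close> is injective on \<open>F\<close>, since each value
  on \<open>Q\<close> is copied from a position outside \<open>Q\<close>. It is applied with
  \<open>F\<close> the extensions containing one given repetition and \<open>Q\<close> one of its
  halves.\<close>

lemma card_colorings_determined_le:
  assumes "finite B" "\<And>i. i \<in> B \<Longrightarrow> finite (L i)"
    and "F \<subseteq> PiE B L"
    and "\<And>f. f \<in> F \<Longrightarrow> restrict f (B - Q) \<in> colorings k L (B - Q)"
    and "\<And>q. q \<in> Q \<Longrightarrow> \<pi> q \<in> B - Q"
    and "\<And>f q. f \<in> F \<Longrightarrow> q \<in> Q \<Longrightarrow> f q = f (\<pi> q)"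
  shows "card F \<le> card (colorings k L (B - Q))"
proof (rule card_inj_on_le)
  show "inj_on (\<lambda>f. restrict f (B - Q)) F"
  proof (rule inj_onI)
    fix f g
    assume fg: "f \<in> F" "g \<in> F" "restrict f (B - Q) = restrict g (B - Q)"
    have out: "f y = g y" if "y \<in> B - Q" for y
      using fun_cong[OF fg(3), of y] that by simp
    show "f = g"
    proof (rule PiE_ext)
      show "f \<in> PiE B L" "g \<in> PiE B L" using fg assms(3) by auto
      show "f y = g y" if "y \<in> B" for y
        using that out assms(5,6) fg(1,2) by (cases "y \<in> Q") (metis, blast)
    qed
  qed
  show "(\<lambda>f. restrict f (B - Q)) ` F \<subseteq> colorings k L (B - Q)" using assms(4) by blast
  show "finite (colorings k L (B - Q))" using assms(1,2) by (intro finite_colorings) auto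
qed

text \<open>The shift by \<open>h * d\<close> exchanges the halves of the progression.
  \<open>Q\<close> is the half holding the term of index \<open>j\<close>, and \<open>\<pi>\<close>
  shifts it up if it is the first half and down if it is the second. As \<open>d\<close> is
  positive, the halves are disjoint.\<close>

lemma repetition_half:
  fixes a d h j :: nat
  assumes "d \<ge> 1" "j < 2 * h"
  obtains Q \<pi> where "Q \<subseteq> progression a d (2 * h)" "a + j * d \<in> Q" "card Q = h"
    and "\<And>q. q \<in> Q \<Longrightarrow> \<pi> q \<in> progression a d (2 * h) - Q"
    and "\<And>f :: nat \<Rightarrow> 'a. \<And>q. repeats f a d h \<Longrightarrow> q \<in> Q \<Longrightarrow> f q = f (\<pi> q)"
proof (cases "j < h")
  case True
  show thesis
  proof (rule that[of "progression a d h" "\<lambda>q. q + h * d"])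
    show "progression a d h \<subseteq> progression a d (2 * h)" "a + j * d \<in> progression a d h"
      using True by (auto simp: progression_def)
    show "card (progression a d h) = h" using assms by (simp add: card_progression)
    show "q + h * d \<in> progression a d (2 * h) - progression a d h" if q: "q \<in> progression a d h" for q
    proof -
      obtain i where i: "i < h" "q = a + i * d" using q unfolding progression_def by blast
      have eq: "q + h * d = a + (i + h) * d" using i by (simp add: algebra_simps)
      have "q + h * d \<in> progression a d (2 * h)"
        unfolding progression_def eq using i by (intro imageI) auto
      moreover have "q + h * d \<notin> progression a d h"
        unfolding progression_def eq using assms by auto
      ultimately show ?thesis by blast
    qed
    show "f q = f (q + h * d)" if "repeats f a d h" "q \<in> progression a d h" for f :: "nat \<Rightarrow> 'a" and q
      using that by (auto simp: progression_def repeats_def algebra_simps)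
  qed
next
  case False
  show thesis
  proof (rule that[of "progression (a + h * d) d h" "\<lambda>q. q - h * d"])
    show "progression (a + h * d) d h \<subseteq> progression a d (2 * h)"
    proof
      fix y assume "y \<in> progression (a + h * d) d h"
      then obtain i where "i < h" "y = a + (i + h) * d"
        by (auto simp: progression_def algebra_simps)
      then show "y \<in> progression a d (2 * h)"
        unfolding progression_def by (intro image_eqI[of _ _ "i + h"]) auto
    qed
    have "a + j * d = a + h * d + (j - h) * d"
      using False by (simp add: diff_mult_distrib)
    then show "a + j * d \<in> progression (a + h * d) d h"
      unfolding progression_def using False assms by (intro image_eqI[of _ _ "j - h"]) auto
    show "card (progression (a + h * d) d h) = h" using assms by (simp add: card_progression)
    show "q - h * d \<in> progression a d (2 * h) - progression (a + h * d) d h"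
      if q: "q \<in> progression (a + h * d) d h" for q
    proof -
      obtain i where i: "i < h" "q = a + h * d + i * d" using q unfolding progression_def by blast
      have eq: "q - h * d = a + i * d" using i by simp
      have "q - h * d \<in> progression a d (2 * h)"
        unfolding progression_def eq using i by (intro imageI) auto
      moreover have "a + i * d < a + h * d" using i assms by simp
      then have "q - h * d \<notin> progression (a + h * d) d h"
        unfolding progression_def eq by (metis (no_types, lifting) imageE le_add1 not_le)
      ultimately show ?thesis by blast
    qed
    show "f q = f (q - h * d)" if "repeats f a d h" "q \<in> progression (a + h * d) d h"
      for f :: "nat \<Rightarrow> 'a" and q
      using that by (auto simp: progression_def repeats_def algebra_simps)
  qed
qed

section \<open>The counting induction\<close>

lemma sum_mult_power_le:
  fixes q :: real
  assumes "0 \<le> q" "q < 1"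
  shows "(\<Sum>h=1..N. real h * q ^ (h - 1)) \<le> 1 / (1 - q)\<^sup>2"
proof -
  \<comment> \<open>Closed form for the partial sums of the differentiated geometric series.\<close>
  have "(1 - q)\<^sup>2 * (\<Sum>h=1..N. real h * q ^ (h - 1)) = 1 - (real N + 1) * q ^ N + real N * q ^ (N + 1)"
    by (induction N) (simp_all add: algebra_simps power2_eq_square)
  also have "\<dots> \<le> 1"
  proof -
    have "real N * q ^ (N + 1) \<le> real N * q ^ N"
      using assms by (intro mult_left_mono power_decreasing) auto
    moreover have "0 \<le> q ^ N" using assms by simp
    ultimately show ?thesis by (simp add: algebra_simps)
  qed
  finally show ?thesis using assms by (simp add: field_simps)
qed

lemma card_colorings_insert:
  fixes L :: "nat \<Rightarrow> 'a set" and \<beta> :: real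
  assumes \<beta>: "\<beta> > 1"
    and L: "\<And>i. i \<in> U \<Longrightarrow> finite (L i)"
      "\<And>i. i \<in> U \<Longrightarrow> real (card (L i)) \<ge> \<beta> + 2 * real k / (1 - 1 / \<beta>)\<^sup>2"
    and "finite A" "insert x A \<subseteq> U" "x \<notin> A"
  shows "\<beta> * card (colorings k L A) \<le> card (colorings k L (insert x A))"
  using assms(4-)
proof (induction "card A" arbitrary: A x rule: less_induct)
  case less
  define c where "c = (\<lambda>A. real (card (colorings k L A)))"
  define B where "B = insert x A"
  have fin: "finite (colorings k L A')" if "A' \<subseteq> B" for A'
    using that less.prems by (intro finite_colorings L finite_subset[OF that]) (auto simp: B_def)
  \<comment> \<open>The induction hypothesis is iterated: putting the points of \<open>D\<close>
    back one at a time gains a factor \<open>\<beta>\<close> each, and every application concerns a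
    proper subset of \<open>A\<close>.\<close>
  have remove: "\<beta> ^ card D * c (A - D) \<le> c A" if "D \<subseteq> A" for D
  proof -
    have "finite D" using that less.prems finite_subset by blast
    then show ?thesis using that
    proof (induction D rule: finite_induct)
      case empty
      show ?case by simp
    next
      case (insert y D)
      have "\<beta> * c (A - insert y D) \<le> c (insert y (A - insert y D))"
        unfolding c_def
      proof (rule less.hyps)
        show "card (A - insert y D) < card A"
          using insert.prems less.prems by (intro psubset_card_mono) auto
      qed (use insert.prems less.prems in auto)
      also have "insert y (A - insert y D) = A - D" using insert by auto
      finally have "\<beta> ^ card D * (\<beta> * c (A - insert y D)) \<le> \<beta> ^ card D * c (A - D)"
        using \<beta> by (intro mult_left_mono) auto
      also have "\<dots> \<le> c A" using insert by simp
      finally show ?case using insert by (simp add: mult.assoc mult.commute mult.left_commute)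
    qed
  qed

  \<comment> \<open>All extensions of good colorings of \<open>A\<close> by a symbol at
    \<open>x\<close>.\<close>
  define E where "E = (\<lambda>(f, y). f(x := y)) ` (colorings k L A \<times> L x)"
  have restrict_upd: "restrict (f(x := y)) A = f" if "f \<in> colorings k L A" for f y
    using that less.prems by (auto simp: colorings_def PiE_iff fun_eq_iff extensional_def)
  have restrict_E: "restrict f A \<in> colorings k L A" if "f \<in> E" for f
    using that restrict_upd by (auto simp: E_def)
  have E_PiE: "E \<subseteq> PiE B L"
  proof
    fix g assume "g \<in> E"
    then obtain f y where "g = f(x := y)" "f \<in> PiE A L" "y \<in> L x"
      by (auto simp: E_def colorings_def)
    then show "g \<in> PiE B L" unfolding B_def by (metis PiE_fun_upd)
  qed
  have "inj_on (\<lambda>(f, y). f(x := y)) (colorings k L A \<times> L x)"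
  proof (rule inj_onI, clarify)
    fix f y g z
    assume fg: "f \<in> colorings k L A" "g \<in> colorings k L A" and eq: "f(x := y) = g(x := z)"
    show "f = g \<and> y = z"
      using restrict_upd[OF fg(1)] restrict_upd[OF fg(2)] eq fun_upd_eqD[OF eq] by metis
  qed
  then have card_E: "real (card E) = real (card (L x)) * c A"
    unfolding E_def c_def by (subst card_image) (auto simp: card_cartesian_product)

  \<comment> \<open>Here \<open>j\<close> is the index of \<open>x\<close> in the progression, which
    therefore starts at \<open>x - j * d\<close>; the conjunct \<open>j * d \<le> x\<close> guards
    against truncated subtraction.\<close>
  define bad where "bad = (\<lambda>(h, d, j). {f \<in> E. j * d \<le> x \<and>
    progression (x - j * d) d (2 * h) \<subseteq> B \<and> repeats f (x - j * d) d h})"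
  have card_bad: "real (card (bad (h, d, j))) \<le> (1 / \<beta>) ^ (h - 1) * c A"
    if "d \<ge> 1" "j < 2 * h" for h d j
  proof (cases "j * d \<le> x \<and> progression (x - j * d) d (2 * h) \<subseteq> B")
    case False
    then have "bad (h, d, j) = {}" by (auto simp: bad_def)
    then show ?thesis using \<beta> by (simp add: c_def)
  next
    case True
    define a where "a = x - j * d"
    have x: "a + j * d = x" and P: "progression a d (2 * h) \<subseteq> B"
      using True by (auto simp: a_def)
    obtain Q \<pi> where Q: "Q \<subseteq> progression a d (2 * h)" "a + j * d \<in> Q" "card Q = h"
      and \<pi>: "\<And>q. q \<in> Q \<Longrightarrow> \<pi> q \<in> progression a d (2 * h) - Q"
      and rep: "\<And>f :: nat \<Rightarrow> 'a. \<And>q. repeats f a d h \<Longrightarrow> q \<in> Q \<Longrightarrow> f q = f (\<pi> q)"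
      using repetition_half[OF \<open>d \<ge> 1\<close> \<open>j < 2 * h\<close>] by metis
    \<comment> \<open>Since \<open>x\<close> lies in \<open>Q\<close> but not in \<open>A\<close>,
      only \<open>h - 1\<close> points are removed from \<open>A\<close>; this is the exponent in
      the bound.\<close>
    have BQ: "B - Q = A - (Q - {x})" "B - Q \<subseteq> A" "Q - {x} \<subseteq> A"
      using Q P x less.prems by (auto simp: B_def)
    have "card (bad (h, d, j)) \<le> card (colorings k L (B - Q))"
    proof (rule card_colorings_determined_le)
      show "finite B" "\<And>i. i \<in> B \<Longrightarrow> finite (L i)" using less.prems L by (auto simp: B_def)
      show "bad (h, d, j) \<subseteq> PiE B L" using E_PiE by (auto simp: bad_def)
      show "\<pi> q \<in> B - Q" if "q \<in> Q" for q using \<pi>[OF that] P by blast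
      show "f q = f (\<pi> q)" if "f \<in> bad (h, d, j)" "q \<in> Q" for f q
        using that rep by (auto simp: bad_def a_def)
      show "restrict f (B - Q) \<in> colorings k L (B - Q)" if "f \<in> bad (h, d, j)" for f
      proof -
        have "restrict f A \<in> colorings k L A" using that restrict_E by (auto simp: bad_def)
        from restrict_colorings[OF this BQ(2)] show ?thesis
          using BQ(2) by (simp add: Int_absorb1)
      qed
    qed
    then have "\<beta> ^ (h - 1) * real (card (bad (h, d, j))) \<le> \<beta> ^ card (Q - {x}) * c (A - (Q - {x}))"
      using Q x \<beta> by (simp add: c_def flip: BQ(1))
    also have "\<dots> \<le> c A" by (rule remove) (rule BQ(3))
    finally show ?thesis using \<beta> by (simp add: field_simps power_one_over)
  qed

  \<comment> \<open>A repetition of size \<open>h\<close> occupies \<open>2 * h\<close> distinct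
    positions of \<open>B\<close>, so sizes up to \<open>card B\<close> suffice and the index set
    \<open>I\<close> is finite.\<close>
  define N where "N = card B"
  define I where "I = (SIGMA h:{1..N}. {1..k} \<times> {..<2 * h})"
  \<comment> \<open>A repetition through \<open>x\<close> puts the extension into some
    \<open>bad p\<close>; one avoiding \<open>x\<close> would already lie in the good coloring of
    \<open>A\<close>.\<close>
  have "E - (\<Union>p\<in>I. bad p) \<subseteq> colorings k L B"
  proof
    fix f assume f: "f \<in> E - (\<Union>p\<in>I. bad p)"
    have "\<not> repeats f a d h"
      if d: "d \<in> {1..k}" and h: "1 \<le> h" and P: "progression a d (2 * h) \<subseteq> B" for a d h
    proof
      assume rep: "repeats f a d h"
      show False
      proof (cases "x \<in> progression a d (2 * h)")
        case True
        then obtain j where j: "j < 2 * h" "x = a + j * d" by (auto simp: progression_def)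
        have "card (progression a d (2 * h)) \<le> N"
          unfolding N_def using P less.prems by (intro card_mono) (auto simp: B_def)
        then have "h \<le> N" using d by (simp add: card_progression)
        then have "(h, d, j) \<in> I" using d h j by (auto simp: I_def)
        moreover have "f \<in> bad (h, d, j)" using f P rep j by (auto simp: bad_def)
        ultimately show False using f by blast
      next
        case False
        then have "progression a d (2 * h) \<subseteq> A" using P by (auto simp: B_def)
        moreover from this have "repeats (restrict f A) a d h"
          using rep by (subst repeats_cong[where g = f]) auto
        ultimately show False using restrict_E[of f] f d h by (auto simp: colorings_def)
      qed
    qed
    then show "f \<in> colorings k L B" using f E_PiE unfolding colorings_def by blast
  qed
  then have "card (E - (\<Union>p\<in>I. bad p)) \<le> card (colorings k L B)"
    by (intro card_mono fin) auto
  moreover have finI: "finite I" by (auto simp: I_def)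
  have finE: "finite E"
    unfolding E_def using fin[of A] L less.prems by (auto simp: B_def)
  have bad_E: "(\<Union>p\<in>I. bad p) \<subseteq> E" by (auto simp: bad_def)
  have "card (E - (\<Union>p\<in>I. bad p)) = card E - card (\<Union>p\<in>I. bad p)"
    using finE bad_E by (intro card_Diff_subset finite_subset[OF bad_E]) auto
  ultimately have lower: "real (card E) - real (card (\<Union>p\<in>I. bad p)) \<le> c B"
    unfolding c_def by linarith
  have "real (card (\<Union>p\<in>I. bad p)) \<le> (\<Sum>p\<in>I. real (card (bad p)))"
    using card_UN_le[OF finI, of bad] by (simp flip: of_nat_sum)
  also have "\<dots> \<le> (\<Sum>p\<in>I. (1 / \<beta>) ^ (fst p - 1) * c A)"
    using card_bad by (intro sum_mono) (auto simp: I_def)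
  also have "\<dots> = (\<Sum>h=1..N. \<Sum>p\<in>{1..k} \<times> {..<2 * h}. (1 / \<beta>) ^ (h - 1) * c A)"
    unfolding I_def by (subst sum.Sigma) (auto intro!: sum.cong)
  \<comment> \<open>Each size \<open>h\<close> comes with \<open>k\<close> differences and
    \<open>2 * h\<close> places for \<open>x\<close>.\<close>
  also have "\<dots> = 2 * real k * c A * (\<Sum>h=1..N. real h * (1 / \<beta>) ^ (h - 1))"
    by (simp add: sum_distrib_left card_cartesian_product mult_ac)
  also have "\<dots> \<le> 2 * real k * c A * (1 / (1 - 1 / \<beta>)\<^sup>2)"
    using \<beta> by (intro mult_left_mono sum_mult_power_le) (auto simp: c_def)
  finally have upper: "real (card (\<Union>p\<in>I. bad p)) \<le> 2 * real k / (1 - 1 / \<beta>)\<^sup>2 * c A"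
    by simp
  have "(\<beta> + 2 * real k / (1 - 1 / \<beta>)\<^sup>2) * c A \<le> real (card E)"
    unfolding card_E using less.prems by (intro mult_right_mono L(2)) (auto simp: c_def)
  then have "\<beta> * c A \<le> c B" using lower upper unfolding distrib_right by linarith
  then show ?case by (simp add: c_def B_def)
qed

section \<open>From counting to sequences\<close>

lemma colorings_nonempty:
  fixes L :: "nat \<Rightarrow> 'a set" and \<beta> :: real
  assumes "\<beta> > 1" "finite U"
    and "\<And>i. i \<in> U \<Longrightarrow> finite (L i)"
    and "\<And>i. i \<in> U \<Longrightarrow> real (card (L i)) \<ge> \<beta> + 2 * real k / (1 - 1 / \<beta>)\<^sup>2"
  shows "colorings k L U \<noteq> {}"
proof -
  have "card (colorings k L A) > 0" if "finite A" "A \<subseteq> U" for A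
    using that
  proof (induction A rule: finite_induct)
    case empty
    \<comment> \<open>The empty set has exactly one coloring; each further position multiplies the
      count by at least \<open>\<beta>\<close>, so it stays positive.\<close>
    have "colorings k L {} = {\<lambda>_. undefined}"
      by (auto simp: colorings_def progression_def lessThan_empty_iff)
    then show ?case by simp
  next
    case (insert x A)
    have "0 < \<beta> * card (colorings k L A)" using insert assms(1) by simp
    also have "\<dots> \<le> card (colorings k L (insert x A))"
      by (rule card_colorings_insert[OF assms(1), where U = U]) (use insert assms(3,4) in auto)
    finally show ?case by simp
  qed
  from this[OF assms(2)] show ?thesis by auto
qed

lemma colorings_nonrepetitive_up_to_mod:
  assumes "s \<in> colorings k L {1..n}"
  shows "nonrepetitive_up_to_mod k n s"
  unfolding nonrepetitive_up_to_mod_def nonrepetitive_def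
proof (intro ballI allI impI notI)
  fix d i h
  assume d: "d \<in> {1..k}" and i: "i \<in> {1..n}" and h: "1 \<le> h"
    and "has_repetition h (mod_subseq n s d i)"
  then obtain us ys vs where ys: "length ys = h" and eq: "mod_subseq n s d i = us @ ys @ ys @ vs"
    unfolding has_repetition_def by blast
  define T where "T = (n - i) div d"
  have ms: "mod_subseq n s d i = map (\<lambda>j. s (i + j * d)) [0..<Suc T]"
    using Greatest_mod_subseq[of i n d] d i by (simp add: mod_subseq_def T_def)
  have len: "Suc T = length us + 2 * h + length vs"
    using arg_cong[OF eq, of length] ys by (simp add: ms)
  \<comment> \<open>Dropping the prefix \<open>us\<close> moves the start of the progression: list
    index \<open>length us + j\<close> is position \<open>a + j * d\<close>.\<close>
  define a where "a = i + length us * d"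
  have val: "(us @ ys @ ys @ vs) ! (length us + j) = s (a + j * d)" if "j < 2 * h" for j
  proof -
    have "length us + j < Suc T" using that len by simp
    then have "mod_subseq n s d i ! (length us + j) = s (i + (length us + j) * d)"
      unfolding ms by (simp del: upt_Suc)
    then show ?thesis by (simp add: eq a_def algebra_simps)
  qed
  have "repeats s a d h"
    unfolding repeats_def
  proof (intro allI impI)
    fix j assume "j < h"
    then show "s (a + j * d) = s (a + (j + h) * d)"
      using val[of j] val[of "j + h"] ys by (simp add: nth_append)
  qed
  moreover have "progression a d (2 * h) \<subseteq> {1..n}"
  proof
    fix y assume "y \<in> progression a d (2 * h)"
    then obtain j where j: "j < 2 * h" "y = i + (length us + j) * d"
      by (auto simp: progression_def a_def algebra_simps)
    have "(length us + j) * d \<le> T * d" using j len by (intro mult_right_mono) auto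
    also have "\<dots> \<le> n - i" by (simp add: T_def)
    finally show "y \<in> {1..n}" using j i by auto
  qed
  ultimately show False using assms d h unfolding colorings_def by blast
qed

theorem theorem1:
  fixes k n :: nat and L :: "nat \<Rightarrow> 'a set"
  assumes "k \<ge> 1" and "n \<ge> 1"
    and "\<And>i. i \<in> {1..n} \<Longrightarrow>
           infinite (L i) \<or> real (card (L i)) \<ge> 2 * real k + 10 * sqrt (real k)"
  shows "\<exists>s :: nat \<Rightarrow> 'a. (\<forall>i\<in>{1..n}. s i \<in> L i) \<and> nonrepetitive_up_to_mod k n s"
proof -
  define r where "r = sqrt (real k)"
  have r: "r \<ge> 1" "r\<^sup>2 = real k" using assms(1) by (auto simp: r_def)
  define \<beta> where "\<beta> = 1 + 2 * r"
  have "1 - 1 / \<beta> = 2 * r / \<beta>" using r by (simp add: \<beta>_def field_simps)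
  \<comment> \<open>With \<open>k = r^2\<close> the factor \<open>r^2\<close> cancels, leaving a
    quadratic in \<open>r\<close> with leading term \<open>2 * r^2 = 2 * k\<close>.\<close>
  then have "2 * real k / (1 - 1 / \<beta>)\<^sup>2 = \<beta>\<^sup>2 / 2"
    using r by (simp add: power_divide power_mult_distrib flip: r(2))
  then have "\<beta> + 2 * real k / (1 - 1 / \<beta>)\<^sup>2 = 2 * real k + 4 * r + 3 / 2"
    unfolding \<beta>_def power2_sum using r(2) by (simp add: power_mult_distrib)
  \<comment> \<open>This amounts to \<open>3 / 2 \<le> 6 * r\<close>, which follows from
    \<open>r \<ge> 1\<close>.\<close>
  then have bound: "\<beta> + 2 * real k / (1 - 1 / \<beta>)\<^sup>2 \<le> 2 * real k + 10 * sqrt (real k)"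
    using r by (simp flip: r_def)
  \<comment> \<open>Counting requires finite lists, and \<open>card\<close> of an infinite set is 0,
    so each infinite list is replaced by a large enough finite subset.\<close>
  have "\<exists>F. F \<subseteq> L i \<and> finite F \<and> real (card F) \<ge> 2 * real k + 10 * sqrt (real k)"
    if "i \<in> {1..n}" for i
  proof (cases "finite (L i)")
    case True
    then show ?thesis using assms(3)[OF that] by blast
  next
    case False
    obtain F where "F \<subseteq> L i" "finite F" "card F = nat \<lceil>2 * real k + 10 * sqrt (real k)\<rceil>"
      using infinite_arbitrarily_large[OF False] by blast
    then show ?thesis using real_nat_ceiling_ge by metis
  qed
  then obtain M where M: "\<And>i. i \<in> {1..n} \<Longrightarrow> M i \<subseteq> L i" "\<And>i. i \<in> {1..n} \<Longrightarrow> finite (M i)"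
    "\<And>i. i \<in> {1..n} \<Longrightarrow> real (card (M i)) \<ge> 2 * real k + 10 * sqrt (real k)"
    by metis
  have "colorings k M {1..n} \<noteq> {}"
  proof (rule colorings_nonempty)
    show "\<beta> > 1" using r by (simp add: \<beta>_def)
    show "real (card (M i)) \<ge> \<beta> + 2 * real k / (1 - 1 / \<beta>)\<^sup>2" if "i \<in> {1..n}" for i
      using M(3)[OF that] bound by linarith
  qed (use M in auto)
  then obtain s where s: "s \<in> colorings k M {1..n}" by blast
  then have "\<forall>i\<in>{1..n}. s i \<in> L i" using M(1) unfolding colorings_def by blast
  with colorings_nonrepetitive_up_to_mod[OF s] show ?thesis by blast
qed

end
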